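(* Let $G$ be a group with finite abelianization $G/G'$, and denote by $G^{(n)}$, $n\ge 0$, the terms of its derived series ($G^{(0)}=G$, $G^{(n+1)}=[G^{(n)},G^{(n)}]$; $G'=G^{(1)}$, $G''=G^{(2)}$). Let $\omega:G\to G/G''$, $x\mapsto xG''$. Then: (1) Every subgroup $U\le G$ which contains $G'$ is a normal subgroup of $G$ of finite index $1\le (G:U)<\infty$. (2) For each $U$ with $G'\unlhd U\unlhd G$ there is a chain of normal subgroups $G''\unlhd U'\unlhd G'\unlhd U\unlhd G$, and $(U/G'')'=U'/G''$. (3) For each $U$ with $G'\unlhd U\unlhd G$, the targets of the transfers $T_{G,U}:G\to U/U'$ and $T_{G/G'',U/G''}:G/G''\to (U/G'')/(U'/G'')$ are equal in the sense of the natural order: $U/U'=(U/G'')/(U'/G'')$, i.e. the epimorphism $\tilde\omega:U/U'\to (U/G'')/(U'/G'')$ induced by $\omega|_U$ is an isomorphism. (4) For each $U$ with $G'\unlhd U\unlhd G$, the kernels of the transfers $T_{G,U}$ and $T_{G/G'',U/G''}$ are equal in the sense of the natural order: $\ker(T_{G,U})=\ker(T_{G/G'',U/G''})$, i.e. $\omega(\ker(T_{G,U}))=\ker(T_{G/G'',U/G''})$, where $\tilde\omega$ is an isomorphism.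
   Context: For a group $G$ and a subgroup $U\le G$ of finite index $n$ with left transversal $(\ell_1,\ldots,\ell_n)$ (so $G$ is the disjoint union of the $\ell_iU$), each $x\in G$ determines a permutation $\lambda_x\in S_n$ with $x\ell_iU=\ell_{\lambda_x(i)}U$. The Artin transfer is the homomorphism $T_{G,U}:G\to U/U'$, $T_{G,U}(x)=\prod_{i=1}^n \ell_{\lambda_x(i)}^{-1}x\ell_i\cdot U'$; it does not depend on the transversal. $U'=[U,U]$ denotes the commutator subgroup. Equality in the sense of the natural order, with respect to an epimorphism $\varphi:G\to H$ with $\varphi(U)=V$ and $\ker(\varphi)\le U$, and the induced epimorphism $\tilde\varphi:U/U'\to V/V'$, $xU'\mapsto\varphi(x)V'$: the targets are called equal, $V/V'=U/U'$, if $\tilde\varphi$ is an isomorphism; the transfer kernels are called equal, $\ker(T_{G,U})=\ker(T_{H,V})$, if $\varphi(\ker(T_{G,U}))=\ker(T_{H,V})$ and $\tilde\varphi$ is an isomorphism. Here $H=G/G''$, $V=U/G''$ and $\varphi=\omega$. *)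

theory Defs
  imports "HOL-Algebra.Algebra" "HOL-Library.Disjoint_Sets"
begin

abbreviation derived_series :: "('a, 'b) monoid_scheme \<Rightarrow> nat \<Rightarrow> 'a set" where
  "derived_series G n \<equiv> (derived G ^^ n) (carrier G)"

abbreviation subgrp :: "('a, 'b) monoid_scheme \<Rightarrow> 'a set \<Rightarrow> ('a, 'b) monoid_scheme" where
  "subgrp G U \<equiv> G\<lparr>carrier := U\<rparr>"

(* The set U/N of cosets of N in U, as a subset of the carrier of G Mod N. *)
abbreviation quot_subgroup :: "('a, 'b) monoid_scheme \<Rightarrow> 'a set \<Rightarrow> 'a set \<Rightarrow> 'a set set" where
  "quot_subgroup G U N \<equiv> carrier (subgrp G U Mod N)"

abbreviation abelianization :: "('a, 'b) monoid_scheme \<Rightarrow> 'a set \<Rightarrow> 'a set monoid" where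
  "abelianization G U \<equiv> subgrp G U Mod derived G U"

definition left_transversal ::
  "('a, 'b) monoid_scheme \<Rightarrow> 'a set \<Rightarrow> nat \<Rightarrow> (nat \<Rightarrow> 'a) \<Rightarrow> bool" where
  "left_transversal G U n l \<longleftrightarrow>
     l ` {1..n} \<subseteq> carrier G \<and>
     disjoint_family_on (\<lambda>i. l i <#\<^bsub>G\<^esub> U) {1..n} \<and>
     (\<Union>i\<in>{1..n}. l i <#\<^bsub>G\<^esub> U) = carrier G"

definition transversal_perm ::
  "('a, 'b) monoid_scheme \<Rightarrow> 'a set \<Rightarrow> nat \<Rightarrow> (nat \<Rightarrow> 'a) \<Rightarrow> 'a \<Rightarrow> nat \<Rightarrow> nat" where
  "transversal_perm G U n l x i =
     (THE j. j \<in> {1..n} \<and> (x \<otimes>\<^bsub>G\<^esub> l i) <#\<^bsub>G\<^esub> U = l j <#\<^bsub>G\<^esub> U)"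

(* The product is formed in G, in the order i = 1, ..., n; all its factors lie in U.  Cosets
   of U' are written as right cosets, following the library's factor groups; as U' is normal
   in U, this is the same set as the left coset. *)
definition artin_transfer_wrt ::
  "('a, 'b) monoid_scheme \<Rightarrow> 'a set \<Rightarrow> nat \<Rightarrow> (nat \<Rightarrow> 'a) \<Rightarrow> 'a \<Rightarrow> 'a set" where
  "artin_transfer_wrt G U n l x =
     derived G U #>\<^bsub>G\<^esub>
       foldr (\<otimes>\<^bsub>G\<^esub>)
         (map (\<lambda>i. inv\<^bsub>G\<^esub> (l (transversal_perm G U n l x i)) \<otimes>\<^bsub>G\<^esub> x \<otimes>\<^bsub>G\<^esub> l i) [1..<Suc n])
         \<one>\<^bsub>G\<^esub>"

(* Meaningful for subgroups U of finite index.  The value does not depend on the chosen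
   transversal, see artin_transfer_eq below. *)
definition artin_transfer :: "('a, 'b) monoid_scheme \<Rightarrow> 'a set \<Rightarrow> 'a \<Rightarrow> 'a set" where
  "artin_transfer G U =
     (case (SOME (n, l). left_transversal G U n l) of (n, l) \<Rightarrow> artin_transfer_wrt G U n l)"

lemma (in subgroup) mem_l_coset_iff:
  assumes "group G" "x \<in> carrier G" "y \<in> carrier G"
  shows "y \<in> x <# H \<longleftrightarrow> inv x \<otimes> y \<in> H"
proof -
  interpret group G by fact
  show ?thesis
    using assms lcos_module_imp[OF assms(1,2)] lcos_module_rev[OF assms(1,2)] by blast
qed

lemma (in group) l_coset_eq_iff:
  assumes "subgroup U G" "x \<in> carrier G" "y \<in> carrier G"
  shows "x <# U = y <# U \<longleftrightarrow> inv x \<otimes> y \<in> U"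
  using assms l_repr_independence[of y x U] lcos_self[of y U]
    subgroup.mem_l_coset_iff[OF assms(1) is_group assms(2,3)] by auto

lemma (in group) left_transversal_ex1:
  assumes U: "subgroup U G" and l: "left_transversal G U n l" and g: "g \<in> carrier G"
  shows "\<exists>!j. j \<in> {1..n} \<and> g <# U = l j <# U"
proof -
  have lc: "l j \<in> carrier G" if "j \<in> {1..n}" for j
    using l that by (auto simp: left_transversal_def)
  obtain j where j: "j \<in> {1..n}" "g \<in> l j <# U"
    using l g unfolding left_transversal_def by blast
  then have eq: "g <# U = l j <# U"
    using l_repr_independence[OF j(2) lc[OF j(1)] U] by simp
  have "i = j" if "i \<in> {1..n}" "g <# U = l i <# U" for i
  proof (rule ccontr)
    assume "i \<noteq> j"
    then have "(l i <# U) \<inter> (l j <# U) = {}"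
      using l that j by (auto simp: left_transversal_def disjoint_family_on_def)
    then show False
      using that eq lcos_self[OF g U] by auto
  qed
  then show ?thesis using j eq by blast
qed

lemma (in group) transversal_perm_props:
  assumes U: "subgroup U G" and l: "left_transversal G U n l" and x: "x \<in> carrier G"
    and i: "i \<in> {1..n}"
  shows "transversal_perm G U n l x i \<in> {1..n}"
    and "(x \<otimes> l i) <# U = l (transversal_perm G U n l x i) <# U"
    and "inv (l (transversal_perm G U n l x i)) \<otimes> x \<otimes> l i \<in> U"
proof -
  have lc: "l j \<in> carrier G" if "j \<in> {1..n}" for j
    using l that by (auto simp: left_transversal_def)
  have ex1: "\<exists>!j. j \<in> {1..n} \<and> (x \<otimes> l i) <# U = l j <# U"
    using left_transversal_ex1[OF U l] x lc[OF i] by simp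
  show 1: "transversal_perm G U n l x i \<in> {1..n}"
    and 2: "(x \<otimes> l i) <# U = l (transversal_perm G U n l x i) <# U"
    using theI'[OF ex1] by (auto simp: transversal_perm_def)
  have "inv (l (transversal_perm G U n l x i)) \<otimes> (x \<otimes> l i) \<in> U"
    using 2[symmetric] l_coset_eq_iff[OF U lc[OF 1]] x lc[OF i] by simp
  then show "inv (l (transversal_perm G U n l x i)) \<otimes> x \<otimes> l i \<in> U"
    using x lc[OF i] lc[OF 1] by (simp add: m_assoc)
qed

lemma (in group) transversal_perm_unique:
  assumes U: "subgroup U G" and l: "left_transversal G U n l" and x: "x \<in> carrier G"
    and i: "i \<in> {1..n}" and j: "j \<in> {1..n}" "(x \<otimes> l i) <# U = l j <# U"
  shows "transversal_perm G U n l x i = j"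
proof -
  have "l i \<in> carrier G"
    using l i by (auto simp: left_transversal_def)
  then have "\<exists>!j. j \<in> {1..n} \<and> (x \<otimes> l i) <# U = l j <# U"
    using left_transversal_ex1[OF U l] x by simp
  then show ?thesis
    unfolding transversal_perm_def using j by (intro the1_equality) auto
qed

lemma (in group) transversal_perm_bij:
  assumes U: "subgroup U G" and l: "left_transversal G U n l" and x: "x \<in> carrier G"
  shows "bij_betw (transversal_perm G U n l x) {1..n} {1..n}"
proof -
  let ?p = "transversal_perm G U n l x"
  have lc: "l j \<in> carrier G" if "j \<in> {1..n}" for j
    using l that by (auto simp: left_transversal_def)
  have "inj_on ?p {1..n}"
  proof (rule inj_onI)
    fix i j assume ij: "i \<in> {1..n}" "j \<in> {1..n}" "?p i = ?p j"
    then have "(x \<otimes> l i) <# U = (x \<otimes> l j) <# U"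
      using transversal_perm_props(2)[OF U l x] by simp
    then have "inv (x \<otimes> l i) \<otimes> (x \<otimes> l j) \<in> U"
      using l_coset_eq_iff[OF U] x lc ij by simp
    also have "inv (x \<otimes> l i) \<otimes> (x \<otimes> l j) = inv (l i) \<otimes> l j"
    proof -
      have "inv x \<otimes> (x \<otimes> l j) = l j"
        using x lc[OF ij(2)] by (simp flip: m_assoc)
      then show ?thesis
        using x lc[OF ij(1)] lc[OF ij(2)] by (simp add: inv_mult_group m_assoc)
    qed
    finally have "l i <# U = l j <# U"
      using l_coset_eq_iff[OF U] lc ij by simp
    then show "i = j"
      using left_transversal_ex1[OF U l lc[OF ij(1)]] ij by blast
  qed
  moreover have "?p ` {1..n} \<subseteq> {1..n}"
    using transversal_perm_props(1)[OF U l x] by blast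
  ultimately show ?thesis
    by (simp add: bij_betw_def endo_inj_surj)
qed

lemma (in group) coset_foldr_eq_finprod:
  assumes U: "subgroup U G" and "distinct is" "a ` set is \<subseteq> U"
  shows "foldr (\<otimes>) (map a is) \<one> \<in> U"
    and "derived G U #> foldr (\<otimes>) (map a is) \<one> =
           finprod (abelianization G U) (\<lambda>i. derived G U #> a i) (set is)"
proof -
  let ?Q = "abelianization G U"
  interpret Q: comm_group ?Q
    using derived_quot_of_subgroup_is_comm_group[OF U] .
  interpret N: normal "derived G U" "subgrp G U"
    using derived_subgroup_is_normal[OF U] .
  have hom: "(\<lambda>x. derived G U #> x) \<in> hom (subgrp G U) ?Q"
    using N.r_coset_hom_Mod by simp
  have "foldr (\<otimes>) (map a is) \<one> \<in> U \<and> derived G U #> foldr (\<otimes>) (map a is) \<one> =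
           finprod ?Q (\<lambda>i. derived G U #> a i) (set is)"
    using assms(2,3)
  proof (induction "is")
    case Nil
    have "derived G U #> \<one> = derived G U"
      using coset_mult_one[OF derived_in_carrier[OF subgroup.subset[OF U]]] .
    then show ?case using U by (simp add: subgroup.one_closed)
  next
    case (Cons i "is")
    then have IH: "foldr (\<otimes>) (map a is) \<one> \<in> U" "derived G U #> foldr (\<otimes>) (map a is) \<one> =
           finprod ?Q (\<lambda>i. derived G U #> a i) (set is)" and ai: "a i \<in> U"
      by auto
    have cl: "derived G U #> a j \<in> carrier ?Q" if "j \<in> set (i # is)" for j
      using hom_in_carrier[OF hom] Cons.prems that by force
    have "derived G U #> (a i \<otimes> foldr (\<otimes>) (map a is) \<one>) =
        (derived G U #> a i) \<otimes>\<^bsub>?Q\<^esub> (derived G U #> foldr (\<otimes>) (map a is) \<one>)"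
      using hom_mult[OF hom, of "a i" "foldr (\<otimes>) (map a is) \<one>"] ai IH(1) by simp
    also have "\<dots> = finprod ?Q (\<lambda>i. derived G U #> a i) (set (i # is))"
      using Cons.prems cl IH(2) by (simp del: mult_FactGroup add: Pi_iff)
    finally show ?case
      using ai IH(1) U by (simp add: subgroup.m_closed)
  qed
  then show "foldr (\<otimes>) (map a is) \<one> \<in> U"
    and "derived G U #> foldr (\<otimes>) (map a is) \<one> =
           finprod ?Q (\<lambda>i. derived G U #> a i) (set is)" by auto
qed

lemma (in group) artin_transfer_wrt_eq_finprod:
  assumes U: "subgroup U G" and l: "left_transversal G U n l" and x: "x \<in> carrier G"
  shows "artin_transfer_wrt G U n l x =
    finprod (abelianization G U)
      (\<lambda>i. derived G U #> (inv (l (transversal_perm G U n l x i)) \<otimes> x \<otimes> l i)) {1..n}"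
proof -
  have "set [1..<Suc n] = {1..n}" by auto
  then show ?thesis
    unfolding artin_transfer_wrt_def
    using coset_foldr_eq_finprod(2)[OF U distinct_upt,
        of "\<lambda>i. inv (l (transversal_perm G U n l x i)) \<otimes> x \<otimes> l i" 1 "Suc n"]
      transversal_perm_props(3)[OF U l x] by (simp add: image_subset_iff)
qed

lemma (in group) artin_transfer_wrt_unique:
  assumes U: "subgroup U G" and l: "left_transversal G U n l" and k: "left_transversal G U m k"
    and x: "x \<in> carrier G"
  shows "artin_transfer_wrt G U n l x = artin_transfer_wrt G U m k x"
proof -
  let ?Q = "abelianization G U"
  define p q where "p = transversal_perm G U n l x" and "q = transversal_perm G U m k x"
  note p = transversal_perm_props[OF U l x, folded p_def]
  note q = transversal_perm_props[OF U k x, folded q_def]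
  interpret Q: comm_group ?Q
    using derived_quot_of_subgroup_is_comm_group[OF U] .
  interpret N: normal "derived G U" "subgrp G U"
    using derived_subgroup_is_normal[OF U] .
  define c where "c = (\<lambda>x. derived G U #> x)"
  have hom: "c \<in> hom (subgrp G U) ?Q"
    unfolding c_def using N.r_coset_hom_Mod by simp
  have cc: "c u \<in> carrier ?Q" if "u \<in> U" for u
    using hom_in_carrier[OF hom] that by simp
  have cm: "c (u \<otimes> v) = c u \<otimes>\<^bsub>?Q\<^esub> c v" if "u \<in> U" "v \<in> U" for u v
    using hom_mult[OF hom] that by simp
  have lc: "l j \<in> carrier G" if "j \<in> {1..n}" for j
    using l that by (auto simp: left_transversal_def)
  have kc: "k j \<in> carrier G" if "j \<in> {1..m}" for j
    using k that by (auto simp: left_transversal_def)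
  define s where "s i = (THE j. j \<in> {1..m} \<and> l i <# U = k j <# U)" for i
  have s: "s i \<in> {1..m}" "l i <# U = k (s i) <# U" if "i \<in> {1..n}" for i
    using theI'[OF left_transversal_ex1[OF U k lc[OF that]]] by (auto simp: s_def)
  have sbij: "bij_betw s {1..n} {1..m}"
    unfolding bij_betw_def
  proof (intro conjI inj_onI equalityI subsetI)
    fix i j assume "i \<in> {1..n}" "j \<in> {1..n}" "s i = s j"
    then show "i = j"
      using left_transversal_ex1[OF U l lc[of i]] s[of i] s[of j] by metis
  next
    fix j assume "j \<in> s ` {1..n}" then show "j \<in> {1..m}" using s by blast
  next
    fix j assume j: "j \<in> {1..m}"
    obtain i where i: "i \<in> {1..n}" "k j <# U = l i <# U"
      using left_transversal_ex1[OF U l kc[OF j]] by blast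
    then have "s i = j"
      using left_transversal_ex1[OF U k lc[OF i(1)]] s[of i] j by metis
    then show "j \<in> s ` {1..n}" using i by blast
  qed
  have shift: "(y \<otimes> g) <# U = y <# (g <# U)" if "y \<in> carrier G" "g \<in> carrier G" for y g
    using lcos_m_assoc[OF subgroup.subset[OF U]] that by simp
  have qs: "q (s i) = s (p i)" if i: "i \<in> {1..n}" for i
    unfolding q_def
  proof (rule transversal_perm_unique[OF U k x s(1)[OF i] s(1)[OF p(1)[OF i]]])
    show "(x \<otimes> k (s i)) <# U = k (s (p i)) <# U"
      using p(2)[OF i] s(2)[OF i] s(2)[OF p(1)[OF i]] shift[OF x lc[OF i]]
        shift[OF x kc[OF s(1)[OF i]]] by simp
  qed
  define u where "u i = inv (l i) \<otimes> k (s i)" for i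
  have uU: "u i \<in> U" if "i \<in> {1..n}" for i
    using s[OF that] l_coset_eq_iff[OF U lc kc] that by (simp add: u_def)
  define a where "a i = inv (l (p i)) \<otimes> x \<otimes> l i" for i
  define b where "b j = inv (k (q j)) \<otimes> x \<otimes> k j" for j
  have aU: "a i \<in> U" if "i \<in> {1..n}" for i
    using p(3)[OF that] by (simp add: a_def)
  have bU: "b i \<in> U" if "i \<in> {1..m}" for i
    using q(3)[OF that] by (simp add: b_def)
  have key: "c (u (p i)) \<otimes>\<^bsub>?Q\<^esub> c (b (s i)) = c (a i) \<otimes>\<^bsub>?Q\<^esub> c (u i)" if i: "i \<in> {1..n}" for i
  proof -
    have carr: "l i \<in> carrier G" "l (p i) \<in> carrier G" "k (s i) \<in> carrier G" "k (s (p i)) \<in> carrier G"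
      using lc kc s p i by auto
    have "u (p i) \<otimes> b (s i) = inv (l (p i)) \<otimes> (k (s (p i)) \<otimes> (inv (k (s (p i))) \<otimes> (x \<otimes> k (s i))))"
      using carr x by (simp add: u_def b_def qs[OF i] m_assoc)
    also have "\<dots> = inv (l (p i)) \<otimes> (x \<otimes> k (s i))"
      using carr x by (simp flip: m_assoc)
    also have "\<dots> = inv (l (p i)) \<otimes> x \<otimes> (l i \<otimes> (inv (l i) \<otimes> k (s i)))"
      using carr x m_assoc[of "l i" "inv (l i)" "k (s i)"] by (simp add: m_assoc)
    also have "\<dots> = a i \<otimes> u i"
      using carr x by (simp add: u_def a_def m_assoc)
    finally show ?thesis
      using cm uU aU bU p(1) s(1) i by metis
  qed
  let ?F = "\<lambda>h. finprod ?Q h {1..n}"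
  have F: "?F (\<lambda>i. c (u i)) \<in> carrier ?Q" "?F (\<lambda>i. c (a i)) \<in> carrier ?Q"
      "?F (\<lambda>i. c (b (s i))) \<in> carrier ?Q"
    using cc uU aU bU s by (auto intro!: Q.finprod_closed)
  have pbij: "bij_betw p {1..n} {1..n}"
    unfolding p_def using transversal_perm_bij[OF U l x] .
  have "?F (\<lambda>i. c (u i)) = ?F (\<lambda>i. c (u (p i)))"
    using Q.finprod_reindex[of "\<lambda>i. c (u i)" p "{1..n}"] pbij cc uU
    by (auto simp: bij_betw_def)
  then have "?F (\<lambda>i. c (u i)) \<otimes>\<^bsub>?Q\<^esub> ?F (\<lambda>i. c (b (s i))) =
      ?F (\<lambda>i. c (u (p i)) \<otimes>\<^bsub>?Q\<^esub> c (b (s i)))"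
    using Q.finprod_multf[of "\<lambda>i. c (u (p i))" "{1..n}" "\<lambda>i. c (b (s i))"] cc uU bU p(1) s(1)
    by (simp del: mult_FactGroup add: Pi_iff)
  also have "\<dots> = ?F (\<lambda>i. c (a i) \<otimes>\<^bsub>?Q\<^esub> c (u i))"
    using key cc uU aU by (intro Q.finprod_cong') (auto simp del: mult_FactGroup)
  also have "\<dots> = ?F (\<lambda>i. c (a i)) \<otimes>\<^bsub>?Q\<^esub> ?F (\<lambda>i. c (u i))"
    using cc uU aU by (intro Q.finprod_multf) auto
  also have "\<dots> = ?F (\<lambda>i. c (u i)) \<otimes>\<^bsub>?Q\<^esub> ?F (\<lambda>i. c (a i))"
    using F by (intro Q.m_comm)
  finally have "?F (\<lambda>i. c (b (s i))) = ?F (\<lambda>i. c (a i))"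
    using F by (simp del: mult_FactGroup)
  moreover have "finprod ?Q (\<lambda>j. c (b j)) {1..m} = ?F (\<lambda>i. c (b (s i)))"
    using Q.finprod_reindex[of "\<lambda>i. c (b i)" s "{1..n}"] sbij cc bU
    by (auto simp: bij_betw_def)
  ultimately show ?thesis
    using artin_transfer_wrt_eq_finprod[OF U l x] artin_transfer_wrt_eq_finprod[OF U k x]
    by (simp add: a_def b_def c_def p_def q_def)
qed

theorem (in group) artin_transfer_eq:
  assumes U: "subgroup U G" and l: "left_transversal G U n l" and x: "x \<in> carrier G"
  shows "artin_transfer G U x = artin_transfer_wrt G U n l x"
proof -
  obtain m k where mk: "(SOME (n, l). left_transversal G U n l) = (m, k)"
    by fastforce
  have "left_transversal G U m k"
    using someI[of "\<lambda>(n, l). left_transversal G U n l" "(n, l)"] l mk by simp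
  then show ?thesis
    using artin_transfer_wrt_unique[OF U _ l x] mk by (simp add: artin_transfer_def)
qed

abbreviation transfer_kernel :: "('a, 'b) monoid_scheme \<Rightarrow> 'a set \<Rightarrow> 'a set" where
  "transfer_kernel G U \<equiv> kernel G (abelianization G U) (artin_transfer G U)"

(* The map U/U' -> V/V', x U' |-> f(x) V', induced by f; the set below is a singleton
   whenever C is a coset of U' in U and f(U) = V. *)
definition induced_map :: "('c, 'd) monoid_scheme \<Rightarrow> 'c set \<Rightarrow> ('a \<Rightarrow> 'c) \<Rightarrow> 'a set \<Rightarrow> 'c set" where
  "induced_map H V f C = the_elem ((\<lambda>x. derived H V #>\<^bsub>H\<^esub> f x) ` C)"

definition natural_order_epi ::
  "('a, 'b) monoid_scheme \<Rightarrow> 'a set \<Rightarrow> ('c, 'd) monoid_scheme \<Rightarrow> 'c set \<Rightarrow> ('a \<Rightarrow> 'c) \<Rightarrow> bool" where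
  "natural_order_epi G U H V f \<longleftrightarrow>
     group G \<and> group H \<and> subgroup U G \<and> f \<in> epi G H \<and> f ` U = V \<and> kernel G H f \<subseteq> U"

definition targets_equal ::
  "('a, 'b) monoid_scheme \<Rightarrow> 'a set \<Rightarrow> ('c, 'd) monoid_scheme \<Rightarrow> 'c set \<Rightarrow> ('a \<Rightarrow> 'c) \<Rightarrow> bool" where
  "targets_equal G U H V f \<longleftrightarrow>
     natural_order_epi G U H V f \<and>
     induced_map H V f \<in> iso (abelianization G U) (abelianization H V)"

definition transfer_kernels_equal ::
  "('a, 'b) monoid_scheme \<Rightarrow> 'a set \<Rightarrow> ('c, 'd) monoid_scheme \<Rightarrow> 'c set \<Rightarrow> ('a \<Rightarrow> 'c) \<Rightarrow> bool" where
  "transfer_kernels_equal G U H V f \<longleftrightarrow>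
     natural_order_epi G U H V f \<and>
     f ` transfer_kernel G U = transfer_kernel H V \<and>
     induced_map H V f \<in> iso (abelianization G U) (abelianization H V)"

end

theory Submission
  imports Defs
begin

text \<open>
  Everything follows from one fact about an epimorphism \<open>h : G \<rightarrow> H\<close> and a subgroup \<open>U\<close> of
  finite index: if \<open>ker h\<close> lies in the commutator subgroup \<open>U'\<close>, then \<open>h\<close> loses no
  information about the transfer to \<open>U/U'\<close>.

  Write \<open>V = h(U)\<close>. Since \<open>V' = h(U')\<close>, the composite \<open>U \<rightarrow> V \<rightarrow> V/V'\<close> is surjective with
  kernel \<open>U' \<cdot> ker h\<close>, which is \<open>U'\<close> under the assumption; so the induced map \<open>U/U' \<rightarrow> V/V'\<close>
  is an isomorphism (lemma \<open>induced_map_iso\<close>).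

  For the kernels, let \<open>l\<close> be a left transversal of \<open>U\<close>. Because \<open>ker h \<le> U\<close>, two cosets of \<open>U\<close>
  agree if and only if their images do; hence \<open>h \<circ> l\<close> is a left transversal of \<open>V\<close>, and \<open>h x\<close>
  permutes it by the same permutation by which \<open>x\<close> permutes \<open>l\<close>. So \<open>h\<close> maps the product
  defining the transfer of \<open>x\<close> factor by factor to the one defining the transfer of \<open>h x\<close>,
  that is, the induced map sends the transfer of \<open>x\<close> to the transfer of \<open>h x\<close> (lemma
  \<open>induced_map_artin_transfer\<close>). As the induced map is injective, \<open>x\<close> lies in the one kernel
  if and only if \<open>h x\<close> lies in the other.

  The assumption on the kernel holds for \<open>G \<rightarrow> G/G''\<close>, because \<open>G' \<le> U\<close> gives
  \<open>G'' = (G')' \<le> U'\<close>. Finally, \<open>U\<close> has finite index since \<open>G/G'\<close> maps onto the cosets of \<open>U\<close>.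
\<close>

section \<open>Subgroups containing the commutator subgroup\<close>

text \<open>A conjugate \<open>g u g\<inverse>\<close> differs from \<open>u\<close> by the commutator of \<open>g\<close> and \<open>u\<close>.\<close>

lemma (in group) normal_if_derived_subset:
  assumes U: "subgroup U G" and "derived G (carrier G) \<subseteq> U"
  shows "U \<lhd> G"
proof -
  have "g \<otimes> u \<otimes> inv g \<in> U" if g: "g \<in> carrier G" and u: "u \<in> U" for g u
  proof -
    have uc: "u \<in> carrier G"
      using U u by (rule subgroup.mem_carrier)
    have "g \<otimes> u \<otimes> inv g \<otimes> inv u \<in> derived G (carrier G)"
      unfolding derived_def by (rule generate.incl) (use g uc in blast)
    then have "(g \<otimes> u \<otimes> inv g \<otimes> inv u) \<otimes> u \<in> U"
      using assms u by (blast intro: subgroup.m_closed)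
    then show ?thesis
      using g uc by (simp add: m_assoc)
  qed
  then show ?thesis
    using U normal_inv_iff by blast
qed

text \<open>Each coset of the larger subgroup \<open>U\<close> is obtained from a coset \<open>C\<close> of \<open>N\<close> as \<open>U C\<close>.\<close>

lemma (in group) finite_rcosets_mono:
  assumes U: "subgroup U G" and N: "subgroup N G" and "N \<subseteq> U" and fin: "finite (rcosets N)"
  shows "finite (rcosets U)"
proof -
  have "U <#> (N #> x) = U #> x" if x: "x \<in> carrier G" for x
  proof -
    have "U <#> N = U"
    proof
      show "U <#> N \<subseteq> U"
        using \<open>N \<subseteq> U\<close> U by (auto simp: set_mult_def intro: subgroup.m_closed)
      show "U \<subseteq> U <#> N"
      proof
        fix u assume "u \<in> U"
        then have "u = u \<otimes> \<one>" using U by (simp add: subgroup.mem_carrier)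
        then show "u \<in> U <#> N"
          using \<open>u \<in> U\<close> N unfolding set_mult_def by (blast intro: subgroup.one_closed)
      qed
    qed
    then show ?thesis
      using setmult_rcos_assoc[OF subgroup.subset[OF U] subgroup.subset[OF N] x] by simp
  qed
  then have "rcosets U \<subseteq> (\<lambda>C. U <#> C) ` (rcosets N)"
    unfolding RCOSETS_def by force
  then show ?thesis
    using fin finite_subset by blast
qed

section \<open>Transversals\<close>

text \<open>
  Cosets are counted on the right, but transversals are taken on the left; inverting the
  representatives of the right cosets passes from one side to the other.
\<close>

lemma (in group) left_transversal_exists:
  assumes U: "subgroup U G" and fin: "finite (rcosets U)"
  shows "\<exists>n l. left_transversal G U n l"
proof -
  obtain c where c: "bij_betw c {1..card (rcosets U)} (rcosets U)"
    using finite_same_card_bij[of "{1..card (rcosets U)}" "rcosets U"] fin by auto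
  define n where "n = card (rcosets U)"
  have "\<exists>r. r \<in> carrier G \<and> c i = U #> r" if "i \<in> {1..n}" for i
    using bij_betwE[OF c] that unfolding n_def RCOSETS_def by blast
  then obtain r where r: "\<And>i. i \<in> {1..n} \<Longrightarrow> r i \<in> carrier G" "\<And>i. i \<in> {1..n} \<Longrightarrow> c i = U #> r i"
    by metis
  define l where "l i = inv (r i)" for i
  have mem: "x \<in> l i <# U \<longleftrightarrow> inv x \<in> c i" if x: "x \<in> carrier G" and i: "i \<in> {1..n}" for x i
  proof -
    have "x \<in> l i <# U \<longleftrightarrow> r i \<otimes> x \<in> U"
      using subgroup.mem_l_coset_iff[OF U is_group, of "l i" x] x r(1)[OF i] by (simp add: l_def)
    also have "\<dots> \<longleftrightarrow> inv (r i \<otimes> x) \<in> U"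
      using U x r(1)[OF i] by (metis inv_inv m_closed subgroup.m_inv_closed)
    also have "\<dots> \<longleftrightarrow> inv x \<in> c i"
      using subgroup.rcos_module[OF U is_group, of "r i" "inv x"] x r[OF i]
      by (simp add: inv_mult_group)
    finally show ?thesis .
  qed
  have lc: "l i \<in> carrier G" if "i \<in> {1..n}" for i
    using r(1)[OF that] by (simp add: l_def)
  have sub: "l i <# U \<subseteq> carrier G" if "i \<in> {1..n}" for i
    using l_coset_subset_G[OF subgroup.subset[OF U] lc[OF that]] .
  have "disjoint_family_on (\<lambda>i. l i <# U) {1..n}"
    unfolding disjoint_family_on_def
  proof (intro ballI impI)
    fix i j assume ij: "i \<in> {1..n}" "j \<in> {1..n}" "i \<noteq> j"
    then have "c i \<in> rcosets U" "c j \<in> rcosets U" "c i \<noteq> c j"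
      using c unfolding n_def bij_betw_def inj_on_def by blast+
    then have "c i \<inter> c j = {}"
      using rcos_disjoint[OF U] unfolding pairwise_def disjnt_def by blast
    then show "(l i <# U) \<inter> (l j <# U) = {}"
      using mem[OF _ ij(1)] mem[OF _ ij(2)] sub[OF ij(1)] by blast
  qed
  moreover have "(\<Union>i\<in>{1..n}. l i <# U) = carrier G"
  proof
    show "carrier G \<subseteq> (\<Union>i\<in>{1..n}. l i <# U)"
    proof
      fix x assume x: "x \<in> carrier G"
      then have "inv x \<in> \<Union>(rcosets U)"
        using rcosets_part_G[OF U] by simp
      then obtain i where "i \<in> {1..n}" "inv x \<in> c i"
        using bij_betw_imp_surj_on[OF c] unfolding n_def by blast
      then show "x \<in> (\<Union>i\<in>{1..n}. l i <# U)"
        using mem x by blast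
    qed
  qed (use sub in blast)
  ultimately show ?thesis
    using lc unfolding left_transversal_def by blast
qed

context group_hom
begin

text \<open>
  Two elements with the same image differ by an element of \<open>ker h \<le> U\<close>. This is what lets \<open>h\<close>
  separate the cosets of \<open>U\<close>.
\<close>

lemma image_mem_iff:
  assumes U: "subgroup U G" and ker: "kernel G H h \<subseteq> U" and x: "x \<in> carrier G"
  shows "h x \<in> h ` U \<longleftrightarrow> x \<in> U"
proof
  assume "h x \<in> h ` U"
  then obtain u where u: "u \<in> U" "h x = h u" by blast
  then have uc: "u \<in> carrier G"
    using U by (simp add: subgroup.mem_carrier)
  then have "x \<otimes> inv u \<in> kernel G H h"
    using x u by (simp add: kernel_def)
  then have "(x \<otimes> inv u) \<otimes> u \<in> U"
    using ker subgroup.m_closed[OF U _ u(1)] by blast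
  then show "x \<in> U"
    using x uc by (simp add: G.m_assoc)
qed simp

lemma l_coset_image_eq_iff:
  assumes U: "subgroup U G" and ker: "kernel G H h \<subseteq> U"
    and x: "x \<in> carrier G" and y: "y \<in> carrier G"
  shows "h x <#\<^bsub>H\<^esub> h ` U = h y <#\<^bsub>H\<^esub> h ` U \<longleftrightarrow> x <# U = y <# U"
proof -
  have "h x <#\<^bsub>H\<^esub> h ` U = h y <#\<^bsub>H\<^esub> h ` U \<longleftrightarrow> h (inv x \<otimes> y) \<in> h ` U"
    using H.l_coset_eq_iff[OF subgroup_img_is_subgroup[OF U], of "h x" "h y"] x y by simp
  also have "\<dots> \<longleftrightarrow> x <# U = y <# U"
    using image_mem_iff[OF U ker, of "inv x \<otimes> y"] G.l_coset_eq_iff[OF U x y] x y by simp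
  finally show ?thesis .
qed

lemma left_transversal_image:
  assumes U: "subgroup U G" and ker: "kernel G H h \<subseteq> U" and surj: "h ` carrier G = carrier H"
    and l: "left_transversal G U n l"
  shows "left_transversal H (h ` U) n (h \<circ> l)"
proof -
  have V: "subgroup (h ` U) H"
    using subgroup_img_is_subgroup[OF U] .
  have lc: "l i \<in> carrier G" if "i \<in> {1..n}" for i
    using l that by (auto simp: left_transversal_def)
  have mem: "h x \<in> h (l i) <#\<^bsub>H\<^esub> h ` U \<longleftrightarrow> x \<in> l i <# U"
    if x: "x \<in> carrier G" and i: "i \<in> {1..n}" for x i
  proof -
    have "h x \<in> h (l i) <#\<^bsub>H\<^esub> h ` U \<longleftrightarrow> h (inv (l i) \<otimes> x) \<in> h ` U"
      using subgroup.mem_l_coset_iff[OF V H.is_group, of "h (l i)" "h x"] x lc[OF i] by simp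
    also have "\<dots> \<longleftrightarrow> x \<in> l i <# U"
      using image_mem_iff[OF U ker, of "inv (l i) \<otimes> x"] x lc[OF i]
        subgroup.mem_l_coset_iff[OF U G.is_group lc[OF i] x] by simp
    finally show ?thesis .
  qed
  have sub: "h (l i) <#\<^bsub>H\<^esub> h ` U \<subseteq> carrier H" if "i \<in> {1..n}" for i
    using H.l_coset_subset_G[OF subgroup.subset[OF V]] lc[OF that] by simp
  have disj: "disjoint_family_on (\<lambda>i. h (l i) <#\<^bsub>H\<^esub> h ` U) {1..n}"
    unfolding disjoint_family_on_def
  proof (intro ballI impI)
    fix i j assume ij: "i \<in> {1..n}" "j \<in> {1..n}" "i \<noteq> j"
    then have "(l i <# U) \<inter> (l j <# U) = {}"
      using l unfolding left_transversal_def disjoint_family_on_def by blast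
    then have "y \<notin> (h (l i) <#\<^bsub>H\<^esub> h ` U) \<inter> (h (l j) <#\<^bsub>H\<^esub> h ` U)" if "y \<in> h ` carrier G" for y
      using mem[OF _ ij(1)] mem[OF _ ij(2)] that by blast
    then show "(h (l i) <#\<^bsub>H\<^esub> h ` U) \<inter> (h (l j) <#\<^bsub>H\<^esub> h ` U) = {}"
      using sub[OF ij(1)] surj by blast
  qed
  have "carrier H \<subseteq> (\<Union>i\<in>{1..n}. h (l i) <#\<^bsub>H\<^esub> h ` U)"
  proof
    fix y assume "y \<in> carrier H"
    then obtain x where x: "x \<in> carrier G" "y = h x"
      using surj by blast
    then obtain i where "i \<in> {1..n}" "x \<in> l i <# U"
      using l unfolding left_transversal_def by blast
    then show "y \<in> (\<Union>i\<in>{1..n}. h (l i) <#\<^bsub>H\<^esub> h ` U)"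
      using mem x by blast
  qed
  then have "(\<Union>i\<in>{1..n}. h (l i) <#\<^bsub>H\<^esub> h ` U) = carrier H"
    using UN_least[OF sub] by (rule equalityI[rotated])
  moreover have "(h \<circ> l) ` {1..n} \<subseteq> carrier H"
    using lc by auto
  ultimately show ?thesis
    unfolding left_transversal_def comp_apply using disj by (intro conjI)
qed

lemma transversal_perm_image:
  assumes U: "subgroup U G" and ker: "kernel G H h \<subseteq> U" and surj: "h ` carrier G = carrier H"
    and l: "left_transversal G U n l" and x: "x \<in> carrier G" and i: "i \<in> {1..n}"
  shows "transversal_perm H (h ` U) n (h \<circ> l) (h x) i = transversal_perm G U n l x i"
proof -
  let ?j = "transversal_perm G U n l x i"
  note p = G.transversal_perm_props[OF U l x i]
  have lc: "l k \<in> carrier G" if "k \<in> {1..n}" for k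
    using l that by (auto simp: left_transversal_def)
  have "h (x \<otimes> l i) <#\<^bsub>H\<^esub> h ` U = h (l ?j) <#\<^bsub>H\<^esub> h ` U"
    using l_coset_image_eq_iff[OF U ker _ lc[OF p(1)], of "x \<otimes> l i"] p(2) x lc[OF i] by blast
  then have "(h x \<otimes>\<^bsub>H\<^esub> (h \<circ> l) i) <#\<^bsub>H\<^esub> h ` U = (h \<circ> l) ?j <#\<^bsub>H\<^esub> h ` U"
    using x lc[OF i] by simp
  then show ?thesis
    using H.transversal_perm_unique[OF subgroup_img_is_subgroup[OF U]
        left_transversal_image[OF U ker surj l] _ i p(1)] x by simp
qed

section \<open>The induced map on abelianizations\<close>

lemma r_coset_derived_hom:
  assumes U: "subgroup U G"
  shows "group_hom (subgrp G U) (abelianization H (h ` U)) (\<lambda>x. derived H (h ` U) #>\<^bsub>H\<^esub> h x)"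
proof -
  have V: "subgroup (h ` U) H"
    using subgroup_img_is_subgroup[OF U] .
  interpret N: normal "derived H (h ` U)" "subgrp H (h ` U)"
    using H.derived_subgroup_is_normal[OF V] .
  have "h \<in> hom (subgrp G U) (subgrp H (h ` U))"
    using U by (auto simp: hom_def subgroup.mem_carrier)
  from Group.hom_compose[OF this N.r_coset_hom_Mod]
  have "(\<lambda>x. derived H (h ` U) #>\<^bsub>H\<^esub> h x) \<in> hom (subgrp G U) (abelianization H (h ` U))"
    by (simp add: comp_def)
  then show ?thesis
    using G.subgroup_imp_group[OF U] N.factorgroup_is_group
    by (simp add: group_hom_def group_hom_axioms_def)
qed

lemma induced_map_r_coset:
  assumes U: "subgroup U G" and u: "u \<in> U"
  shows "induced_map H (h ` U) h (derived G U #> u) = derived H (h ` U) #>\<^bsub>H\<^esub> h u"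
  unfolding induced_map_def
proof (rule the_elem_image_unique)
  have Uc: "U \<subseteq> carrier G"
    using U by (rule subgroup.subset)
  have D: "subgroup (derived G U) G"
    using G.derived_is_subgroup[OF Uc] .
  show "derived G U #> u \<noteq> {}"
    using G.rcos_self[OF _ D] u Uc by blast
  fix y assume "y \<in> derived G U #> u"
  then obtain d where d: "d \<in> derived G U" "y = d \<otimes> u"
    unfolding r_coset_def by blast
  have dc: "d \<in> carrier G"
    using D d(1) by (rule subgroup.mem_carrier)
  have D': "subgroup (derived H (h ` U)) H"
    using H.derived_is_subgroup[OF subgroup.subset[OF subgroup_img_is_subgroup[OF U]]] .
  have "h d \<in> derived H (h ` U)"
    using derived_img[OF Uc] d(1) by simp
  then have "derived H (h ` U) #>\<^bsub>H\<^esub> h d = derived H (h ` U)"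
    using subgroup.rcos_const[OF D' H.is_group] by simp
  then show "derived H (h ` U) #>\<^bsub>H\<^esub> h y = derived H (h ` U) #>\<^bsub>H\<^esub> h u"
    using H.coset_mult_assoc[OF subgroup.subset[OF D'], of "h d" "h u"] d(2) dc u Uc by auto
qed

text \<open>
  By \<open>image_mem_iff\<close> for the subgroup \<open>U'\<close>, the preimage of \<open>V' = h(U')\<close> in \<open>U\<close> is exactly \<open>U'\<close>,
  so the claim is the first isomorphism theorem for \<open>U \<rightarrow> V/V'\<close>.
\<close>

lemma induced_map_iso:
  assumes U: "subgroup U G" and ker: "kernel G H h \<subseteq> derived G U"
  shows "induced_map H (h ` U) h \<in> iso (abelianization G U) (abelianization H (h ` U))"
proof -
  let ?q = "\<lambda>x. derived H (h ` U) #>\<^bsub>H\<^esub> h x"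
  interpret q: group_hom "subgrp G U" "abelianization H (h ` U)" ?q
    using r_coset_derived_hom[OF U] .
  have Uc: "U \<subseteq> carrier G"
    using U by (rule subgroup.subset)
  have D: "subgroup (derived G U) G"
    using G.derived_is_subgroup[OF Uc] .
  have D': "subgroup (derived H (h ` U)) H"
    using H.derived_is_subgroup[OF subgroup.subset[OF subgroup_img_is_subgroup[OF U]]] .
  have "?q x = derived H (h ` U) \<longleftrightarrow> x \<in> derived G U" if "x \<in> U" for x
  proof -
    have x: "x \<in> carrier G"
      using that Uc by blast
    have "?q x = derived H (h ` U) \<longleftrightarrow> h x \<in> derived H (h ` U)"
      using H.coset_join1[OF _ hom_closed[OF x] D'] H.coset_join2[OF hom_closed[OF x] D'] by (rule iffI)
    then show ?thesis
      using derived_img[OF Uc] image_mem_iff[OF D ker x] by simp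
  qed
  then have "kernel (subgrp G U) (abelianization H (h ` U)) ?q = derived G U"
    unfolding kernel_def using G.derived_incl[OF order_refl U] by auto
  moreover have "?q ` carrier (subgrp G U) = carrier (abelianization H (h ` U))"
    by (simp add: carrier_FactGroup image_image)
  moreover have "induced_map H (h ` U) h = (\<lambda>C. the_elem (?q ` C))"
    by (simp add: induced_map_def fun_eq_iff)
  ultimately show ?thesis
    using q.FactGroup_iso_set by simp
qed

section \<open>Transfers and epimorphisms\<close>

lemma image_foldr_mult:
  assumes "set xs \<subseteq> carrier G"
  shows "h (foldr (\<otimes>) xs \<one>) = foldr (\<otimes>\<^bsub>H\<^esub>) (map h xs) \<one>\<^bsub>H\<^esub>"
proof -
  have "foldr (\<otimes>) xs \<one> \<in> carrier G \<and> h (foldr (\<otimes>) xs \<one>) = foldr (\<otimes>\<^bsub>H\<^esub>) (map h xs) \<one>\<^bsub>H\<^esub>"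
    using assms by (induction xs) auto
  then show ?thesis ..
qed

text \<open>
  With respect to \<open>l\<close> and \<open>h \<circ> l\<close> the two transfers are products over the same indices in the
  same order, and the permutations agree, so \<open>h\<close> can be pulled through the product.
\<close>

lemma induced_map_artin_transfer:
  assumes U: "subgroup U G" and ker: "kernel G H h \<subseteq> U" and surj: "h ` carrier G = carrier H"
    and fin: "finite (rcosets U)" and x: "x \<in> carrier G"
  shows "artin_transfer G U x \<in> carrier (abelianization G U)"
    and "induced_map H (h ` U) h (artin_transfer G U x) = artin_transfer H (h ` U) (h x)"
proof -
  obtain n l where l: "left_transversal G U n l"
    using G.left_transversal_exists[OF U fin] by blast
  have lc: "l i \<in> carrier G" if "i \<in> {1..n}" for i
    using l that by (auto simp: left_transversal_def)
  define p where "p = transversal_perm G U n l x"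
  note p = G.transversal_perm_props[OF U l x, folded p_def]
  define a where "a i = inv (l (p i)) \<otimes> x \<otimes> l i" for i
  have idx: "set [1..<Suc n] = {1..n}" by auto
  have aU: "a ` {1..n} \<subseteq> U"
    using p(3) by (auto simp: a_def)
  define u where "u = foldr (\<otimes>) (map a [1..<Suc n]) \<one>"
  have u: "u \<in> U"
    unfolding u_def
    by (rule G.coset_foldr_eq_finprod(1)[OF U distinct_upt]) (simp only: idx aU)
  have T: "artin_transfer G U x = derived G U #> u"
    using G.artin_transfer_eq[OF U l x]
    by (simp only: artin_transfer_wrt_def u_def a_def[abs_def] p_def)
  show "artin_transfer G U x \<in> carrier (abelianization G U)"
    unfolding T using u by (simp add: carrier_FactGroup)
  have factor: "h (a i) = inv\<^bsub>H\<^esub> ((h \<circ> l) (transversal_perm H (h ` U) n (h \<circ> l) (h x) i))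
      \<otimes>\<^bsub>H\<^esub> h x \<otimes>\<^bsub>H\<^esub> (h \<circ> l) i" if i: "i \<in> {1..n}" for i
    using transversal_perm_image[OF U ker surj l x i] x lc[OF i] lc[OF p(1)[OF i]]
    by (simp add: a_def p_def)
  have "set (map a [1..<Suc n]) \<subseteq> carrier G"
    unfolding list.set_map idx using aU subgroup.subset[OF U] by (rule subset_trans)
  then have "h u = foldr (\<otimes>\<^bsub>H\<^esub>) (map (\<lambda>i. h (a i)) [1..<Suc n]) \<one>\<^bsub>H\<^esub>"
    unfolding u_def using image_foldr_mult by (simp add: comp_def del: upt_Suc)
  also have "map (\<lambda>i. h (a i)) [1..<Suc n] =
      map (\<lambda>i. inv\<^bsub>H\<^esub> ((h \<circ> l) (transversal_perm H (h ` U) n (h \<circ> l) (h x) i))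
        \<otimes>\<^bsub>H\<^esub> h x \<otimes>\<^bsub>H\<^esub> (h \<circ> l) i) [1..<Suc n]"
    by (rule map_cong[OF refl]) (rule factor, simp only: idx)
  finally have "derived H (h ` U) #>\<^bsub>H\<^esub> h u = artin_transfer_wrt H (h ` U) n (h \<circ> l) (h x)"
    by (simp only: artin_transfer_wrt_def)
  then show "induced_map H (h ` U) h (artin_transfer G U x) = artin_transfer H (h ` U) (h x)"
    using H.artin_transfer_eq[OF subgroup_img_is_subgroup[OF U]
        left_transversal_image[OF U ker surj l], of "h x"] x
      induced_map_r_coset[OF U u] T by simp
qed

lemma natural_order_epi_image:
  assumes "subgroup U G" and "kernel G H h \<subseteq> U" and "h ` carrier G = carrier H"
  shows "natural_order_epi G U H (h ` U) h"
  using assms homh by (simp add: natural_order_epi_def epi_def)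

theorem targets_equal_image:
  assumes U: "subgroup U G" and ker: "kernel G H h \<subseteq> derived G U"
    and surj: "h ` carrier G = carrier H"
  shows "targets_equal G U H (h ` U) h"
proof -
  have "kernel G H h \<subseteq> U"
    using ker G.derived_incl[OF order_refl U] by blast
  then show ?thesis
    using natural_order_epi_image[OF U _ surj] induced_map_iso[OF U ker]
    by (simp add: targets_equal_def)
qed

text \<open>
  The induced map intertwines the two transfers and, being injective, sends no coset other than
  \<open>U'\<close> to \<open>V'\<close>; surjectivity of \<open>h\<close> then reaches all of the kernel in \<open>H\<close>.
\<close>

theorem transfer_kernels_equal_image:
  assumes U: "subgroup U G" and ker: "kernel G H h \<subseteq> derived G U"
    and surj: "h ` carrier G = carrier H" and fin: "finite (rcosets U)"
  shows "transfer_kernels_equal G U H (h ` U) h"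
proof -
  have ker': "kernel G H h \<subseteq> U"
    using ker G.derived_incl[OF order_refl U] by blast
  let ?\<phi> = "induced_map H (h ` U) h"
  have iso: "?\<phi> \<in> iso (abelianization G U) (abelianization H (h ` U))"
    using induced_map_iso[OF U ker] .
  note T = induced_map_artin_transfer[OF U ker' surj fin]
  have grp: "group (abelianization G U)" "group (abelianization H (h ` U))"
    using G.derived_quot_of_subgroup_is_comm_group[OF U]
      H.derived_quot_of_subgroup_is_comm_group[OF subgroup_img_is_subgroup[OF U]]
    by (simp_all add: comm_group_def)
  have one: "derived G U \<in> carrier (abelianization G U)"
    using monoid.one_closed[OF group.is_monoid[OF grp(1)]] by simp
  have \<phi>_one: "?\<phi> (derived G U) = derived H (h ` U)"
    using Group.hom_one[OF _ grp, of ?\<phi>] iso by (simp add: iso_def)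
  have inj: "inj_on ?\<phi> (carrier (abelianization G U))"
    using iso by (simp add: iso_def bij_betw_def)
  have iff: "artin_transfer G U x = derived G U \<longleftrightarrow>
      artin_transfer H (h ` U) (h x) = derived H (h ` U)" if "x \<in> carrier G" for x
    using inj_on_eq_iff[OF inj T(1)[OF that] one] T(2)[OF that] \<phi>_one by simp
  have "h ` transfer_kernel G U = transfer_kernel H (h ` U)"
    unfolding kernel_def one_FactGroup surj[symmetric] using iff by blast
  then show ?thesis
    using natural_order_epi_image[OF U ker' surj] iso by (simp add: transfer_kernels_equal_def)
qed

end

section \<open>The projection onto a factor group\<close>

lemma quot_subgroup_eq_image: "quot_subgroup G U N = (\<lambda>x. N #>\<^bsub>G\<^esub> x) ` U"
  by (simp add: carrier_FactGroup)

lemma (in normal) r_coset_group_hom: "group_hom G (G Mod H) (\<lambda>x. H #> x)"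
  using r_coset_hom_Mod factorgroup_is_group is_group
  by (simp add: group_hom_def group_hom_axioms_def)

lemma (in normal) kernel_r_coset: "kernel G (G Mod H) (\<lambda>x. H #> x) = H"
  using coset_join1[OF _ _ subgroup_axioms] coset_join2[OF _ subgroup_axioms] subset
  by (auto simp: kernel_def)

section \<open>Transfers of a group and of its second derived quotient\<close>

theorem theorem5p4:
  fixes G :: "('a, 'm) monoid_scheme"
  assumes "group G"
    and "finite (carrier (G Mod derived_series G 1))"
  shows
    "(\<forall>U. subgroup U G \<and> derived_series G 1 \<subseteq> U \<longrightarrow>
        U \<lhd> G \<and> finite (rcosets\<^bsub>G\<^esub> U) \<and> 1 \<le> card (rcosets\<^bsub>G\<^esub> U))
     \<and>
     (\<forall>U. U \<lhd> G \<and> derived_series G 1 \<lhd> subgrp G U \<longrightarrow>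
        derived_series G 2 \<lhd> subgrp G (derived G U) \<and>
        derived G U \<lhd> subgrp G (derived_series G 1) \<and>
        derived_series G 1 \<lhd> subgrp G U \<and>
        U \<lhd> G \<and>
        derived_series G 2 \<lhd> G \<and> derived G U \<lhd> G \<and> derived_series G 1 \<lhd> G \<and>
        derived (G Mod derived_series G 2) (quot_subgroup G U (derived_series G 2))
          = quot_subgroup G (derived G U) (derived_series G 2))
     \<and>
     (\<forall>U. U \<lhd> G \<and> derived_series G 1 \<lhd> subgrp G U \<longrightarrow>
        targets_equal G U
          (G Mod derived_series G 2) (quot_subgroup G U (derived_series G 2))
          (\<lambda>x. derived_series G 2 #>\<^bsub>G\<^esub> x))
     \<and>
     (\<forall>U. U \<lhd> G \<and> derived_series G 1 \<lhd> subgrp G U \<longrightarrow>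
        transfer_kernels_equal G U
          (G Mod derived_series G 2) (quot_subgroup G U (derived_series G 2))
          (\<lambda>x. derived_series G 2 #>\<^bsub>G\<^esub> x))"
proof -
  interpret group G by fact
  let ?G1 = "derived_series G 1" and ?G2 = "derived_series G 2"
  have G1: "?G1 = derived G (carrier G)"
    by simp
  have G2: "?G2 = derived G ?G1"
    by (simp add: numeral_2_eq_2)
  have n1: "?G1 \<lhd> G"
    unfolding G1 by (rule derived_self_is_normal)
  have n2: "?G2 \<lhd> G"
    unfolding G2 by (rule derived_is_normal[OF n1])
  have fin1: "finite (rcosets\<^bsub>G\<^esub> ?G1)"
    using assms(2) by (simp add: FactGroup_def)
  have fin: "finite (rcosets\<^bsub>G\<^esub> U)" if "subgroup U G" "?G1 \<subseteq> U" for U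
    using finite_rcosets_mono[OF that(1) normal_imp_subgroup[OF n1] that(2) fin1] .
  interpret n2: normal ?G2 G
    by (rule n2)
  let ?\<omega> = "\<lambda>x. ?G2 #>\<^bsub>G\<^esub> x"
  interpret \<omega>: group_hom G "G Mod ?G2" ?\<omega>
    by (rule n2.r_coset_group_hom)
  have surj: "?\<omega> ` carrier G = carrier (G Mod ?G2)"
    by (simp add: carrier_FactGroup)

  have part1: "U \<lhd> G \<and> finite (rcosets\<^bsub>G\<^esub> U) \<and> 1 \<le> card (rcosets\<^bsub>G\<^esub> U)"
    if U: "subgroup U G" and sub: "?G1 \<subseteq> U" for U
  proof -
    have "rcosets\<^bsub>G\<^esub> U \<noteq> {}"
      using subgroup.subgroup_in_rcosets[OF U is_group] by blast
    then have "1 \<le> card (rcosets\<^bsub>G\<^esub> U)"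
      using fin[OF U sub] by (simp add: Suc_le_eq card_gt_0_iff)
    then show ?thesis
      using normal_if_derived_subset[OF U] sub fin[OF U sub] by simp
  qed

  have intermediate: "subgroup U G" "?G1 \<subseteq> U" "?G2 \<subseteq> derived G U"
    if "U \<lhd> G" "?G1 \<lhd> subgrp G U" for U
  proof -
    show "subgroup U G"
      using that(1) by (rule normal_imp_subgroup)
    show "?G1 \<subseteq> U"
      using subgroup.subset[OF normal_imp_subgroup[OF that(2)]] by simp
    then show "?G2 \<subseteq> derived G U"
      unfolding G2 by (rule mono_derived)
  qed

  have part2: "?G2 \<lhd> subgrp G (derived G U) \<and> derived G U \<lhd> subgrp G ?G1 \<and>
      derived G U \<lhd> G \<and>
      derived (G Mod ?G2) (quot_subgroup G U ?G2) = quot_subgroup G (derived G U) ?G2"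
    if U: "U \<lhd> G" "?G1 \<lhd> subgrp G U" for U
  proof -
    note i = intermediate[OF U]
    have nD: "derived G U \<lhd> G"
      using derived_is_normal[OF U(1)] .
    have "derived G U \<subseteq> ?G1"
      unfolding G1 by (rule mono_derived[OF subgroup.subset[OF i(1)]])
    then have "derived G U \<lhd> subgrp G ?G1"
      using normal_restrict_supergroup[OF normal_imp_subgroup[OF n1] nD] by blast
    moreover have "?G2 \<lhd> subgrp G (derived G U)"
      using normal_restrict_supergroup[OF normal_imp_subgroup[OF nD] n2 i(3)] .
    ultimately show ?thesis
      using nD \<omega>.derived_img[OF subgroup.subset[OF i(1)]]
      by (simp only: quot_subgroup_eq_image simp_thms)
  qed

  have part3: "targets_equal G U (G Mod ?G2) (quot_subgroup G U ?G2) ?\<omega>"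
    if U: "U \<lhd> G" "?G1 \<lhd> subgrp G U" for U
    unfolding quot_subgroup_eq_image
    by (rule \<omega>.targets_equal_image[OF intermediate(1)[OF U] _ surj])
      (simp only: n2.kernel_r_coset intermediate(3)[OF U])

  have part4: "transfer_kernels_equal G U (G Mod ?G2) (quot_subgroup G U ?G2) ?\<omega>"
    if U: "U \<lhd> G" "?G1 \<lhd> subgrp G U" for U
    unfolding quot_subgroup_eq_image
    by (rule \<omega>.transfer_kernels_equal_image[OF intermediate(1)[OF U] _ surj
          fin[OF intermediate(1,2)[OF U]]])
      (simp only: n2.kernel_r_coset intermediate(3)[OF U])

  show ?thesis
    using part1 part2 part3 part4 n1 n2 by blast
qed

end
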